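(* Let $(U,M,V,W,A,B)$ be functions of the null coordinates $(u,v)$ giving an Einstein–Maxwell colliding plane wave solution, i.e. satisfying, with zero scalar field ($\phi=0$), the complete colliding Einstein–Maxwell–scalar (CEMS) system written out in the context. Then solutions of the CEMS system with scalar field $\phi\neq 0$ can be generated from it by making a shift in the metric function $M$, $$M\longrightarrow \widetilde M=M+\Gamma ,$$ where the shift function $\Gamma(u,v)$ must satisfy $$\Gamma_uU_u=2\phi_u^2,\qquad \Gamma_vU_v=2\phi_v^2 .$$ That is, for such $\phi$ and $\Gamma$, $(U,M+\Gamma,V,W,A,B,\phi)$ is a solution of the CEMS system, with $U,V,W,A,B$ unchanged.
   Context: Subscripts $u,v$ on functions denote partial derivatives. The functions describe the colliding plane wave metric $$ds^2=2e^{-M}du\,dv-e^{-U}\left[(e^{V}dx^2+e^{-V}dy^2)\cosh W-2\sinh W\,dx\,dy\right],$$ the electromagnetic potential one-form $\tilde A=A\,dx+B\,dy$, and a massless, minimally coupled scalar field $\phi$, where $U,M,V,W,A,B,\phi$ depend at most on $(u,v)$. The constant $k$ is a coupling constant (it can be fixed as $1$). The Newman–Penrose spinors of the electromagnetic field are ($i=\sqrt{-1}$, bar denotes complex conjugation) $$\Phi_2=\frac{e^{U/2}}{\sqrt2}\left[e^{-V/2}\left(i\sinh\tfrac W2-\cosh\tfrac W2\right)A_u+e^{V/2}\left(i\cosh\tfrac W2-\sinh\tfrac W2\right)B_u\right],$$ $$\Phi_0=\frac{e^{U/2}}{\sqrt2}\left[e^{-V/2}\left(i\sinh\tfrac W2+\cosh\tfrac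 W2\right)A_v+e^{V/2}\left(i\cosh\tfrac W2+\sinh\tfrac W2\right)B_v\right].$$ The complete CEMS system for $(U,M,V,W,A,B,\phi)$ consists of the equations $$U_{uv}=U_uU_v,$$ $$2M_{uv}=-U_uU_v+W_uW_v+V_uV_v\cosh^2W+4\phi_u\phi_v,$$ $$2V_{uv}=U_vV_u+U_uV_v-2(V_uW_v+V_vW_u)\tanh W-2k\,\mathrm{sech}\,W\,(\bar\Phi_0\Phi_2+\bar\Phi_2\Phi_0),$$ $$2W_{uv}=U_vW_u+U_uW_v+2V_uV_v\cosh W\sinh W+2ki(\bar\Phi_0\Phi_2-\bar\Phi_2\Phi_0),$$ $$2\phi_{uv}=U_v\phi_u+U_u\phi_v,$$ $$2A_{uv}=V_vA_u+V_uA_v-\tanh W(W_vA_u+W_uA_v)-e^{V}\left[2B_{uv}\tanh W+W_uB_v+W_vB_u\right],$$ $$2B_{uv}=-V_vB_u-V_uB_v-\tanh W(W_vB_u+W_uB_v)-e^{V}\left[2A_{uv}\tanh W+W_uA_v+W_vA_u\right],$$ $$2U_{uu}-U_u^2+2M_uU_u=W_u^2+V_u^2\cosh^2W+4\phi_u^2+4k\,\Phi_2\bar\Phi_2,$$ $$2U_{vv}-U_v^2+2M_vU_v=W_v^2+V_v^2\cosh^2W+4\phi_v^2+4k\,\Phi_0\bar\Phi_0 .$$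
   Formalization: Two hypotheses are added, as the claim fails without them: φ satisfies the scalar wave equation 2φ_uv = U_vφ_u + U_uφ_v, and U_u, U_v do not both vanish on any nonempty open set (else U=M=V=W=A=B=0, φ=1, Γ=uv is a counterexample). All functions are taken C² on an open set. *)

theory Defs
  imports "HOL-Analysis.Analysis"
begin

text \<open>Functions of the null coordinates are functions on \<open>real \<times> real\<close>, evaluated at \<open>p = (u, v)\<close>.\<close>

definition du :: "(real \<times> real \<Rightarrow> real) \<Rightarrow> real \<times> real \<Rightarrow> real" where
  "du f p = deriv (\<lambda>s. f (s, snd p)) (fst p)"

definition dv :: "(real \<times> real \<Rightarrow> real) \<Rightarrow> real \<times> real \<Rightarrow> real" where
  "dv f p = deriv (\<lambda>t. f (fst p, t)) (snd p)"

text \<open>Since \<open>deriv\<close> is total, existence of the partial derivatives is part of the regularity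
  notion. Both predicates are meant for open sets.\<close>

definition C1_on :: "(real \<times> real) set \<Rightarrow> (real \<times> real \<Rightarrow> real) \<Rightarrow> bool" where
  "C1_on D f \<longleftrightarrow>
     (\<forall>p\<in>D. (\<lambda>s. f (s, snd p)) differentiable at (fst p)
           \<and> (\<lambda>t. f (fst p, t)) differentiable at (snd p)) \<and>
     continuous_on D (du f) \<and> continuous_on D (dv f)"

definition C2_on :: "(real \<times> real) set \<Rightarrow> (real \<times> real \<Rightarrow> real) \<Rightarrow> bool" where
  "C2_on D f \<longleftrightarrow> C1_on D f \<and> C1_on D (du f) \<and> C1_on D (dv f)"

definition Phi2 ::
  "(real \<times> real \<Rightarrow> real) \<Rightarrow> (real \<times> real \<Rightarrow> real) \<Rightarrow> (real \<times> real \<Rightarrow> real) \<Rightarrow>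
   (real \<times> real \<Rightarrow> real) \<Rightarrow> (real \<times> real \<Rightarrow> real) \<Rightarrow> real \<times> real \<Rightarrow> complex" where
  "Phi2 U V W A B p =
     complex_of_real (exp (U p / 2) / sqrt 2) *
       (complex_of_real (exp (- V p / 2)) *
          (\<i> * complex_of_real (sinh (W p / 2)) - complex_of_real (cosh (W p / 2))) *
          complex_of_real (du A p)
      + complex_of_real (exp (V p / 2)) *
          (\<i> * complex_of_real (cosh (W p / 2)) - complex_of_real (sinh (W p / 2))) *
          complex_of_real (du B p))"

definition Phi0 ::
  "(real \<times> real \<Rightarrow> real) \<Rightarrow> (real \<times> real \<Rightarrow> real) \<Rightarrow> (real \<times> real \<Rightarrow> real) \<Rightarrow>
   (real \<times> real \<Rightarrow> real) \<Rightarrow> (real \<times> real \<Rightarrow> real) \<Rightarrow> real \<times> real \<Rightarrow> complex" where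
  "Phi0 U V W A B p =
     complex_of_real (exp (U p / 2) / sqrt 2) *
       (complex_of_real (exp (- V p / 2)) *
          (\<i> * complex_of_real (sinh (W p / 2)) + complex_of_real (cosh (W p / 2))) *
          complex_of_real (dv A p)
      + complex_of_real (exp (V p / 2)) *
          (\<i> * complex_of_real (cosh (W p / 2)) + complex_of_real (sinh (W p / 2))) *
          complex_of_real (dv B p))"

text \<open>The colliding Einstein--Maxwell--scalar system on \<open>D\<close> for the metric
  \<open>ds\<^sup>2 = 2 e\<^sup>-\<^sup>M du dv - e\<^sup>-\<^sup>U ((e\<^sup>V dx\<^sup>2 + e\<^sup>-\<^sup>V dy\<^sup>2) cosh W - 2 sinh W dx dy)\<close>,
  the potential \<open>A dx + B dy\<close> and the scalar field \<open>\<phi>\<close>. Equations in which the spinors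
  occur are stated in the complex numbers; \<open>sech W\<close> is written \<open>1 / cosh W\<close>.\<close>

definition CEMS_solution ::
  "real \<Rightarrow> (real \<times> real) set \<Rightarrow>
   (real \<times> real \<Rightarrow> real) \<Rightarrow> (real \<times> real \<Rightarrow> real) \<Rightarrow> (real \<times> real \<Rightarrow> real) \<Rightarrow>
   (real \<times> real \<Rightarrow> real) \<Rightarrow> (real \<times> real \<Rightarrow> real) \<Rightarrow> (real \<times> real \<Rightarrow> real) \<Rightarrow>
   (real \<times> real \<Rightarrow> real) \<Rightarrow> bool" where
  "CEMS_solution k D U M V W A B \<phi> \<longleftrightarrow>
     C2_on D U \<and> C2_on D M \<and> C2_on D V \<and> C2_on D W \<and> C2_on D A \<and> C2_on D B \<and> C2_on D \<phi> \<and>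
     (\<forall>p\<in>D.
        dv (du U) p = du U p * dv U p \<and>
        2 * dv (du M) p =
          - du U p * dv U p + du W p * dv W p + du V p * dv V p * (cosh (W p))\<^sup>2
          + 4 * du \<phi> p * dv \<phi> p \<and>
        complex_of_real (2 * dv (du V) p) =
          complex_of_real (dv U p * du V p + du U p * dv V p
             - 2 * (du V p * dv W p + dv V p * du W p) * tanh (W p))
          - complex_of_real (2 * k * (1 / cosh (W p)))
             * (cnj (Phi0 U V W A B p) * Phi2 U V W A B p
                + cnj (Phi2 U V W A B p) * Phi0 U V W A B p) \<and>
        complex_of_real (2 * dv (du W) p) =
          complex_of_real (dv U p * du W p + du U p * dv W p
             + 2 * du V p * dv V p * cosh (W p) * sinh (W p))
          + complex_of_real (2 * k) * \<i>
             * (cnj (Phi0 U V W A B p) * Phi2 U V W A B p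
                - cnj (Phi2 U V W A B p) * Phi0 U V W A B p) \<and>
        2 * dv (du \<phi>) p = dv U p * du \<phi> p + du U p * dv \<phi> p \<and>
        2 * dv (du A) p =
          dv V p * du A p + du V p * dv A p
          - tanh (W p) * (dv W p * du A p + du W p * dv A p)
          - exp (V p) * (2 * dv (du B) p * tanh (W p) + du W p * dv B p + dv W p * du B p) \<and>
        2 * dv (du B) p =
          - dv V p * du B p - du V p * dv B p
          - tanh (W p) * (dv W p * du B p + du W p * dv B p)
          - exp (V p) * (2 * dv (du A) p * tanh (W p) + du W p * dv A p + dv W p * du A p) \<and>
        complex_of_real (2 * du (du U) p - (du U p)\<^sup>2 + 2 * du M p * du U p) =
          complex_of_real ((du W p)\<^sup>2 + (du V p)\<^sup>2 * (cosh (W p))\<^sup>2 + 4 * (du \<phi> p)\<^sup>2)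
          + complex_of_real (4 * k) * (Phi2 U V W A B p * cnj (Phi2 U V W A B p)) \<and>
        complex_of_real (2 * dv (dv U) p - (dv U p)\<^sup>2 + 2 * dv M p * dv U p) =
          complex_of_real ((dv W p)\<^sup>2 + (dv V p)\<^sup>2 * (cosh (W p))\<^sup>2 + 4 * (dv \<phi> p)\<^sup>2)
          + complex_of_real (4 * k) * (Phi0 U V W A B p * cnj (Phi0 U V W A B p)))"

end

theory Submission
  imports Defs
begin

text \<open>The only equation that is not immediate is the one for \<open>M\<^sub>u\<^sub>v\<close>, which needs
  \<open>\<Gamma>\<^sub>u\<^sub>v = 2 \<phi>\<^sub>u \<phi>\<^sub>v\<close>. Differentiating \<open>\<Gamma>\<^sub>u U\<^sub>u = 2 \<phi>\<^sub>u\<^sup>2\<close> in \<open>v\<close> and using the equations for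
  \<open>U\<^sub>u\<^sub>v\<close> and \<open>\<phi>\<^sub>u\<^sub>v\<close> gives \<open>U\<^sub>u (\<Gamma>\<^sub>u\<^sub>v - 2 \<phi>\<^sub>u \<phi>\<^sub>v) = 0\<close>; exchanging the roles of \<open>u\<close> and \<open>v\<close>,
  which requires equality of mixed partial derivatives, gives \<open>U\<^sub>v (\<Gamma>\<^sub>u\<^sub>v - 2 \<phi>\<^sub>u \<phi>\<^sub>v) = 0\<close>.
  Hence the identity holds off the set \<open>U\<^sub>u = U\<^sub>v = 0\<close>, whose complement is dense, and
  everywhere by continuity.\<close>

section \<open>Calculus of the partial derivatives: locality, sums and regularity\<close>

lemma C1_onD:
  assumes "C1_on D f" "p \<in> D"
  shows C1_on_has_du: "((\<lambda>s. f (s, snd p)) has_real_derivative du f p) (at (fst p))"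
    and C1_on_has_dv: "((\<lambda>t. f (fst p, t)) has_real_derivative dv f p) (at (snd p))"
  using assms by (auto simp: C1_on_def du_def dv_def DERIV_deriv_iff_real_differentiable)

lemma eventually_du_line:
  fixes p :: "real \<times> real"
  assumes "open D" "p \<in> D"
  shows "\<forall>\<^sub>F s in nhds (fst p). (s, snd p) \<in> D"
proof -
  have "open ((\<lambda>s. (s, snd p)) -` D)"
    by (intro open_vimage assms continuous_intros)
  then show ?thesis
    using eventually_nhds_in_open[of "(\<lambda>s. (s, snd p)) -` D" "fst p"] assms by simp
qed

lemma eventually_dv_line:
  fixes p :: "real \<times> real"
  assumes "open D" "p \<in> D"
  shows "\<forall>\<^sub>F t in nhds (snd p). (fst p, t) \<in> D"
proof -
  have "open ((\<lambda>t. (fst p, t)) -` D)"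
    by (intro open_vimage assms continuous_intros)
  then show ?thesis
    using eventually_nhds_in_open[of "(\<lambda>t. (fst p, t)) -` D" "snd p"] assms by simp
qed

lemma du_add:
  assumes "C1_on D f" "C1_on D g" "p \<in> D"
  shows "du (\<lambda>p. f p + g p) p = du f p + du g p"
  using DERIV_add[OF C1_on_has_du[OF assms(1,3)] C1_on_has_du[OF assms(2,3)]]
  by (simp add: du_def DERIV_imp_deriv)

lemma dv_add:
  assumes "C1_on D f" "C1_on D g" "p \<in> D"
  shows "dv (\<lambda>p. f p + g p) p = dv f p + dv g p"
  using DERIV_add[OF C1_on_has_dv[OF assms(1,3)] C1_on_has_dv[OF assms(2,3)]]
  by (simp add: dv_def DERIV_imp_deriv)

lemma C1_on_add:
  assumes "C1_on D f" "C1_on D g"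
  shows "C1_on D (\<lambda>p. f p + g p)"
proof -
  have "continuous_on D (du (\<lambda>p. f p + g p))" "continuous_on D (dv (\<lambda>p. f p + g p))"
    using assms du_add[OF assms] dv_add[OF assms]
    by (simp_all add: C1_on_def continuous_on_add cong: continuous_on_cong)
  with assms show ?thesis
    by (auto simp: C1_on_def intro: differentiable_add)
qed

text \<open>A partial derivative at \<open>p\<close> sees only the coordinate line through
  \<open>p\<close>, and openness keeps nearby points of that line in \<open>D\<close>. Identities
  assumed on \<open>D\<close> alone can therefore be differentiated.\<close>

lemma du_cong:
  assumes "open D" "p \<in> D" "\<And>q. q \<in> D \<Longrightarrow> f q = g q"
  shows "du f p = du g p"
  unfolding du_def
  by (rule deriv_cong_ev[OF eventually_mono[OF eventually_du_line[OF assms(1,2)]]])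
     (simp_all add: assms(3))

lemma dv_cong:
  assumes "open D" "p \<in> D" "\<And>q. q \<in> D \<Longrightarrow> f q = g q"
  shows "dv f p = dv g p"
  unfolding dv_def
  by (rule deriv_cong_ev[OF eventually_mono[OF eventually_dv_line[OF assms(1,2)]]])
     (simp_all add: assms(3))

text \<open>Serves \<open>C2_on_add\<close>: the sum rule identifies
  \<open>du (\<lambda>p. f p + g p)\<close> with \<open>du f + du g\<close> only on
  \<open>D\<close>, so regularity has to pass between functions that agree just there.\<close>

lemma C1_on_cong:
  assumes "open D" "C1_on D f" "\<And>q. q \<in> D \<Longrightarrow> f q = g q"
  shows "C1_on D g"
proof -
  have "continuous_on D (du g)" "continuous_on D (dv g)"
    using assms(2) du_cong[OF assms(1) _ assms(3)] dv_cong[OF assms(1) _ assms(3)]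
    by (simp_all add: C1_on_def cong: continuous_on_cong)
  moreover have "(\<lambda>s. g (s, snd p)) differentiable at (fst p)" if "p \<in> D" for p
  proof -
    have "\<forall>\<^sub>F s in nhds (fst p). f (s, snd p) = g (s, snd p)"
      using eventually_du_line[OF assms(1) that] by eventually_elim (rule assms(3))
    from DERIV_cong_ev[OF refl this refl] C1_on_has_du[OF assms(2) that]
    have "((\<lambda>s. g (s, snd p)) has_real_derivative du f p) (at (fst p))" by (rule iffD1)
    then show ?thesis by (auto simp: real_differentiable_def)
  qed
  moreover have "(\<lambda>t. g (fst p, t)) differentiable at (snd p)" if "p \<in> D" for p
  proof -
    have "\<forall>\<^sub>F t in nhds (snd p). f (fst p, t) = g (fst p, t)"
      using eventually_dv_line[OF assms(1) that] by eventually_elim (rule assms(3))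
    from DERIV_cong_ev[OF refl this refl] C1_on_has_dv[OF assms(2) that]
    have "((\<lambda>t. g (fst p, t)) has_real_derivative dv f p) (at (snd p))" by (rule iffD1)
    then show ?thesis by (auto simp: real_differentiable_def)
  qed
  ultimately show ?thesis by (simp add: C1_on_def)
qed

lemma C2_on_add:
  assumes "open D" "C2_on D f" "C2_on D g"
  shows "C2_on D (\<lambda>p. f p + g p)"
proof -
  have 1: "C1_on D f" "C1_on D g" using assms by (auto simp: C2_on_def)
  have "C1_on D (du (\<lambda>p. f p + g p))"
    by (rule C1_on_cong[OF assms(1) C1_on_add[of D "du f" "du g"]])
       (use assms du_add[OF 1] in \<open>auto simp: C2_on_def\<close>)
  moreover have "C1_on D (dv (\<lambda>p. f p + g p))"
    by (rule C1_on_cong[OF assms(1) C1_on_add[of D "dv f" "dv g"]])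
       (use assms dv_add[OF 1] in \<open>auto simp: C2_on_def\<close>)
  ultimately show ?thesis using C1_on_add[OF 1] by (simp add: C2_on_def)
qed

lemma dv_du_add:
  assumes "open D" "C2_on D f" "C2_on D g" "p \<in> D"
  shows "dv (du (\<lambda>p. f p + g p)) p = dv (du f) p + dv (du g) p"
proof -
  have "dv (du (\<lambda>p. f p + g p)) p = dv (\<lambda>p. du f p + du g p) p"
    using assms by (intro dv_cong[OF assms(1,4)] du_add) (auto simp: C2_on_def)
  also have "\<dots> = dv (du f) p + dv (du g) p"
    using assms by (intro dv_add) (auto simp: C2_on_def)
  finally show ?thesis .
qed

subsection \<open>Symmetry of mixed partial derivatives\<close>

text \<open>Two applications of the mean value theorem: first to the difference of \<open>f\<close>
  along the top and bottom edges of the square, then to \<open>du f\<close> along the vertical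
  segment at the resulting \<open>x\<close>.\<close>

lemma second_difference_eq_dv_du:
  assumes "C1_on D f" "C1_on D (du f)" "h > 0" "{a..a+h} \<times> {b..b+h} \<subseteq> D"
  obtains x y where "x \<in> {a..a+h}" "y \<in> {b..b+h}"
    "f (a+h, b+h) - f (a+h, b) - f (a, b+h) + f (a, b) = h * (h * dv (du f) (x, y))"
proof -
  have "((\<lambda>s. f (s, b+h) - f (s, b)) has_real_derivative (du f (x, b+h) - du f (x, b))) (at x)"
    if "a \<le> x" "x \<le> a+h" for x
  proof -
    have "(x, b+h) \<in> D" "(x, b) \<in> D" using assms(3,4) that by auto
    then show ?thesis
      using C1_on_has_du[OF assms(1), of "(x, b+h)"] C1_on_has_du[OF assms(1), of "(x, b)"]
      by (intro DERIV_diff) auto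
  qed
  from MVT2[OF _ this, of a "a+h"] obtain x where x: "a < x" "x < a+h"
    and "f (a+h, b+h) - f (a+h, b) - (f (a, b+h) - f (a, b)) = h * (du f (x, b+h) - du f (x, b))"
    using \<open>h > 0\<close> by auto
  moreover have "((\<lambda>t. du f (x, t)) has_real_derivative dv (du f) (x, y)) (at y)"
    if "b \<le> y" "y \<le> b+h" for y
  proof -
    have "(x, y) \<in> D" using assms(3,4) that x by auto
    then show ?thesis using C1_on_has_dv[OF assms(2), of "(x, y)"] by simp
  qed
  from MVT2[OF _ this, of b "b+h"] obtain y where "b < y" "y < b+h"
    "du f (x, b+h) - du f (x, b) = h * dv (du f) (x, y)"
    using \<open>h > 0\<close> by auto
  ultimately show ?thesis by (intro that[of x y]) auto
qed

text \<open>Exchanging the coordinates turns each result on \<open>dv (du f)\<close> into one on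
  \<open>du (dv f)\<close>, which spares a second proof for the other variable.\<close>

lemma du_swap: "du (\<lambda>p. f (prod.swap p)) = (\<lambda>p. dv f (prod.swap p))"
  and dv_swap: "dv (\<lambda>p. f (prod.swap p)) = (\<lambda>p. du f (prod.swap p))"
  by (simp_all add: fun_eq_iff du_def dv_def)

lemma C1_on_swap:
  assumes "C1_on D f"
  shows "C1_on (prod.swap ` D) (\<lambda>p. f (prod.swap p))"
proof -
  have "continuous_on (prod.swap ` D) (\<lambda>p. g (prod.swap p))" if "continuous_on D g"
    for g :: "real \<times> real \<Rightarrow> real"
    by (rule continuous_on_compose2[OF that continuous_on_swap]) auto
  with assms show ?thesis
    by (auto simp: C1_on_def du_swap dv_swap)
qed

lemma C2_on_swap:
  assumes "C2_on D f"
  shows "C2_on (prod.swap ` D) (\<lambda>p. f (prod.swap p))"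
  using assms by (simp add: C2_on_def C1_on_swap du_swap dv_swap)

lemma open_swap_image:
  fixes D :: "(real \<times> real) set"
  assumes "open D"
  shows "open (prod.swap ` D)"
proof -
  have "prod.swap ` D = prod.swap -` D" by force
  then show ?thesis using assms by (simp add: open_vimage continuous_on_swap)
qed

text \<open>Schwarz's theorem. The second difference over a square is invariant under the swap, so
  on each small square with corner \<open>p\<close> both mixed derivatives attain a common value,
  possibly at different points; continuity at \<open>p\<close> then forces equality.\<close>

lemma dv_du_eq_du_dv:
  assumes "open D" "C2_on D f" "p \<in> D"
  shows "dv (du f) p = du (dv f) p"
proof (rule ccontr)
  assume neq: "dv (du f) p \<noteq> du (dv f) p"
  \<comment> \<open>Half the gap: no number lies within \<open>e\<close> of both mixed derivatives
    at \<open>p\<close>.\<close>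
  define e where "e = dist (dv (du f) p) (du (dv f) p) / 2"
  have "e > 0" using neq by (simp add: e_def)
  have C: "C1_on D f" "C1_on D (du f)" "C1_on D (dv f)"
    using assms by (auto simp: C2_on_def)
  have "\<forall>\<^sub>F q in nhds p. dist (dv (du f) q) (dv (du f) p) < e"
    "\<forall>\<^sub>F q in nhds p. dist (du (dv f) q) (du (dv f) p) < e"
    using C assms \<open>e > 0\<close>
    by (auto simp: C1_on_def continuous_on_eq_continuous_at isCont_def tendsto_at_iff_tendsto_nhds
        intro!: tendstoD)
  moreover have "\<forall>\<^sub>F q in nhds p. q \<in> D"
    using assms by (simp add: eventually_nhds_in_open)
  ultimately have "\<forall>\<^sub>F q in nhds p. q \<in> D \<and> dist (dv (du f) q) (dv (du f) p) < e
      \<and> dist (du (dv f) q) (du (dv f) p) < e"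
    by eventually_elim auto
  then obtain S where S: "open S" "p \<in> S" "\<And>q. q \<in> S \<Longrightarrow> q \<in> D"
    "\<And>q. q \<in> S \<Longrightarrow> dist (dv (du f) q) (dv (du f) p) < e"
    "\<And>q. q \<in> S \<Longrightarrow> dist (du (dv f) q) (du (dv f) p) < e"
    unfolding eventually_nhds by blast
  obtain a b where p: "p = (a, b)" by (cases p)
  obtain X Y where XY: "open X" "open Y" "a \<in> X" "b \<in> Y" "X \<times> Y \<subseteq> S"
    using open_prod_elim[OF S(1,2)] p by (metis mem_Sigma_iff)
  obtain d1 d2 where d: "d1 > 0" "cball a d1 \<subseteq> X" "d2 > 0" "cball b d2 \<subseteq> Y"
    using XY by (meson open_contains_cball)
  define h where "h = min d1 d2"
  have "h > 0" using d by (simp add: h_def)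
  have "{a..a+h} \<subseteq> X" "{b..b+h} \<subseteq> Y"
    using d by (auto simp: h_def subset_eq dist_real_def)
  have box: "(x, y) \<in> S" if "x \<in> {a..a+h}" "y \<in> {b..b+h}" for x y
    using XY(5) \<open>{a..a+h} \<subseteq> X\<close> \<open>{b..b+h} \<subseteq> Y\<close> that by (meson SigmaI subsetD)
  then have D: "{a..a+h} \<times> {b..b+h} \<subseteq> D" using S(3) by auto
  obtain x y where "x \<in> {a..a+h}" "y \<in> {b..b+h}" and xy:
    "f (a+h, b+h) - f (a+h, b) - f (a, b+h) + f (a, b) = h * (h * dv (du f) (x, y))"
    using second_difference_eq_dv_du[OF C(1,2) \<open>h > 0\<close> D] .
  then have "(x, y) \<in> S" using box by simp
  let ?g = "\<lambda>p. f (prod.swap p)"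
  have g: "C1_on (prod.swap ` D) ?g" "C1_on (prod.swap ` D) (du ?g)"
    using C1_on_swap C by (auto simp: du_swap)
  \<comment> \<open>The same square with its sides exchanged, to read the second difference in the
    other order.\<close>
  have "{b..b+h} \<times> {a..a+h} \<subseteq> prod.swap ` D"
    using D by force
  from second_difference_eq_dv_du[OF g \<open>h > 0\<close> this]
  obtain y' x' where "y' \<in> {b..b+h}" "x' \<in> {a..a+h}" and
    "?g (b+h, a+h) - ?g (b+h, a) - ?g (b, a+h) + ?g (b, a) = h * (h * dv (du ?g) (y', x'))" .
  then have "(x', y') \<in> S" and xy':
    "f (a+h, b+h) - f (a, b+h) - f (a+h, b) + f (a, b) = h * (h * du (dv f) (x', y'))"
    using box by (simp_all add: du_swap dv_swap)
  have "h * (h * dv (du f) (x, y)) = h * (h * du (dv f) (x', y'))"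
    using xy xy' by linarith
  then have "dv (du f) (x, y) = du (dv f) (x', y')" using \<open>h > 0\<close> by simp
  then show False
    using S(4)[OF \<open>(x, y) \<in> S\<close>] S(5)[OF \<open>(x', y') \<in> S\<close>] dist_triangle_half_r
    unfolding e_def by (metis less_irrefl)
qed

subsection \<open>The shift of \<open>M\<close>\<close>

lemma dv_shift_equation:
  assumes "open D" "p \<in> D" "C1_on D (du U)" "C1_on D (du \<phi>)" "C1_on D (du \<Gamma>)"
    and "dv (du U) p = du U p * dv U p"
    and "2 * dv (du \<phi>) p = dv U p * du \<phi> p + du U p * dv \<phi> p"
    and "\<And>q. q \<in> D \<Longrightarrow> du \<Gamma> q * du U q = 2 * (du \<phi> q)\<^sup>2"
  shows "du U p * (dv (du \<Gamma>) p - 2 * du \<phi> p * dv \<phi> p) = 0"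
proof -
  note D = C1_on_has_dv[OF assms(3,2)] C1_on_has_dv[OF assms(4,2)] C1_on_has_dv[OF assms(5,2)]
  have "dv (\<lambda>q. du \<Gamma> q * du U q) p = dv (du \<Gamma>) p * du U p + du \<Gamma> p * dv (du U) p"
    using DERIV_imp_deriv[OF DERIV_mult[OF D(3) D(1)]] by (simp add: dv_def mult.commute)
  moreover have "dv (\<lambda>q. 2 * (du \<phi> q)\<^sup>2) p = 4 * du \<phi> p * dv (du \<phi>) p"
    using DERIV_imp_deriv[OF DERIV_cmult[OF DERIV_power[OF D(2)], of 2 2]]
    by (simp add: dv_def mult_ac)
  moreover have "dv (\<lambda>q. du \<Gamma> q * du U q) p = dv (\<lambda>q. 2 * (du \<phi> q)\<^sup>2) p"
    using assms(8) by (intro dv_cong[OF assms(1,2)])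
  \<comment> \<open>Regrouped so that \<open>2 * dv (du \<phi>) p\<close>, the left side of the wave
    equation, can be replaced.\<close>
  moreover have "4 * du \<phi> p * dv (du \<phi>) p = 2 * du \<phi> p * (2 * dv (du \<phi>) p)"
    by simp
  ultimately have "dv (du \<Gamma>) p * du U p + du \<Gamma> p * (du U p * dv U p)
      = 2 * du \<phi> p * (dv U p * du \<phi> p + du U p * dv \<phi> p)"
    using assms(6,7) by metis
  \<comment> \<open>At \<open>p\<close> the shift relation turns
    \<open>du \<Gamma> p * du U p * dv U p\<close> into
    \<open>2 * (du \<phi> p)\<^sup>2 * dv U p\<close>, which cancels against the right side.\<close>
  with assms(8)[OF assms(2)] show ?thesis by algebra
qed

lemma dv_du_shift:
  assumes "open D" "C2_on D U" "C2_on D \<phi>" "C2_on D \<Gamma>"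
    and U: "\<And>p. p \<in> D \<Longrightarrow> dv (du U) p = du U p * dv U p"
    and \<phi>: "\<And>p. p \<in> D \<Longrightarrow> 2 * dv (du \<phi>) p = dv U p * du \<phi> p + du U p * dv \<phi> p"
    and \<Gamma>u: "\<And>p. p \<in> D \<Longrightarrow> du \<Gamma> p * du U p = 2 * (du \<phi> p)\<^sup>2"
    and \<Gamma>v: "\<And>p. p \<in> D \<Longrightarrow> dv \<Gamma> p * dv U p = 2 * (dv \<phi> p)\<^sup>2"
    and int: "interior {p \<in> D. du U p = 0 \<and> dv U p = 0} = {}"
    and "p \<in> D"
  shows "dv (du \<Gamma>) p = 2 * du \<phi> p * dv \<phi> p"
proof (rule ccontr)
  assume neq: "dv (du \<Gamma>) p \<noteq> 2 * du \<phi> p * dv \<phi> p"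
  let ?d = "\<lambda>q. dv (du \<Gamma>) q - 2 * du \<phi> q * dv \<phi> q"
  have "continuous_on D ?d"
    using assms(2-4) unfolding C2_on_def C1_on_def by (intro continuous_intros) simp_all
  then have "open (?d -` (- {0}) \<inter> D)"
    using \<open>open D\<close> by (simp add: continuous_on_open_vimage open_Compl)
  \<comment> \<open>Where the defect \<open>?d\<close> is nonzero, both derivatives of
    \<open>U\<close> must vanish. This open set thus lies in a set with empty interior and is itself
    empty.\<close>
  moreover have "?d -` (- {0}) \<inter> D \<subseteq> {p \<in> D. du U p = 0 \<and> dv U p = 0}"
  proof
    fix q assume "q \<in> ?d -` (- {0}) \<inter> D"
    moreover obtain a b where ab: "q = (a, b)" by (cases q)
    ultimately have q: "(a, b) \<in> D" and nz: "?d (a, b) \<noteq> 0" by auto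
    have "du U (a, b) * ?d (a, b) = 0"
      using assms q by (intro dv_shift_equation[of D]) (auto simp: C2_on_def)
    with nz have "du U (a, b) = 0" by simp
    let ?sw = "\<lambda>f p. f (prod.swap p) :: real"
    have sym: "dv (du f) q = du (dv f) q" if "C2_on D f" "q \<in> D" for f q
      using that \<open>open D\<close> by (simp add: dv_du_eq_du_dv)
    \<comment> \<open>The \<open>v\<close> version comes from the swapped functions at
      \<open>(b, a)\<close>; symmetry of mixed partials brings their equations for \<open>U\<close>
      and \<phi> back to the given ones.\<close>
    have "du (?sw U) (b, a) * (dv (du (?sw \<Gamma>)) (b, a) - 2 * du (?sw \<phi>) (b, a) * dv (?sw \<phi>) (b, a)) = 0"
    proof (rule dv_shift_equation[OF open_swap_image[OF \<open>open D\<close>]])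
      show "C1_on (prod.swap ` D) (du (?sw U))" "C1_on (prod.swap ` D) (du (?sw \<phi>))"
        "C1_on (prod.swap ` D) (du (?sw \<Gamma>))"
        using C2_on_swap assms(2-4) by (auto simp: C2_on_def)
    qed (use q U[OF q] \<phi>[OF q] \<Gamma>v sym[OF assms(2) q] sym[OF assms(3) q] in
        \<open>auto simp: du_swap dv_swap\<close>)
    then have "dv U (a, b) * ?d (a, b) = 0"
      using sym[OF assms(4) q] by (simp add: du_swap dv_swap algebra_simps)
    with nz have "dv U (a, b) = 0" by simp
    with \<open>du U (a, b) = 0\<close> q ab show "q \<in> {p \<in> D. du U p = 0 \<and> dv U p = 0}" by simp
  qed
  ultimately have "?d -` (- {0}) \<inter> D \<subseteq> interior {p \<in> D. du U p = 0 \<and> dv U p = 0}"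
    by (rule interior_maximal[rotated])
  then have "?d -` (- {0}) \<inter> D \<subseteq> {}"
    unfolding int .
  with neq \<open>p \<in> D\<close> show False by auto
qed

theorem theorem1:
  fixes k :: real and D :: "(real \<times> real) set"
    and U M V W A B \<phi> \<Gamma> :: "real \<times> real \<Rightarrow> real"
  assumes "open D"
    and "CEMS_solution k D U M V W A B (\<lambda>p. 0)"
    and "interior {p \<in> D. du U p = 0 \<and> dv U p = 0} = {}"
    and "C2_on D \<phi>"
    and "\<exists>p\<in>D. \<phi> p \<noteq> 0"
    and "\<forall>p\<in>D. 2 * dv (du \<phi>) p = dv U p * du \<phi> p + du U p * dv \<phi> p"
    and "C2_on D \<Gamma>"
    and "\<forall>p\<in>D. du \<Gamma> p * du U p = 2 * (du \<phi> p)\<^sup>2"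
    and "\<forall>p\<in>D. dv \<Gamma> p * dv U p = 2 * (dv \<phi> p)\<^sup>2"
  shows "CEMS_solution k D U (\<lambda>p. M p + \<Gamma> p) V W A B \<phi>"
proof -
  note sol = assms(2)[unfolded CEMS_solution_def]
  have zero: "du (\<lambda>p. 0) = (\<lambda>p. 0)" "dv (\<lambda>p. 0) = (\<lambda>p. 0)"
    by (simp_all add: fun_eq_iff du_def dv_def)
  have C2: "C2_on D U" "C2_on D M" using sol by auto
  have C1: "C1_on D M" "C1_on D \<Gamma>" using C2 assms(7) by (auto simp: C2_on_def)
  have M: "du (\<lambda>p. M p + \<Gamma> p) p = du M p + du \<Gamma> p"
    "dv (\<lambda>p. M p + \<Gamma> p) p = dv M p + dv \<Gamma> p"
    "dv (du (\<lambda>p. M p + \<Gamma> p)) p = dv (du M) p + 2 * du \<phi> p * dv \<phi> p" if "p \<in> D" for p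
  proof -
    have "dv (du \<Gamma>) p = 2 * du \<phi> p * dv \<phi> p"
      by (rule dv_du_shift[OF assms(1) C2(1) assms(4,7)]) (use sol assms that in auto)
    then show "dv (du (\<lambda>p. M p + \<Gamma> p)) p = dv (du M) p + 2 * du \<phi> p * dv \<phi> p"
      using dv_du_add[OF assms(1) C2(2) assms(7) that] by simp
  qed (use du_add[OF C1 that] dv_add[OF C1 that] in auto)
  \<comment> \<open>The shift adds \<open>2 * du \<Gamma> p * du U p\<close> to the left side of the
    \<open>du (du U)\<close> equation, which is exactly its scalar term
    \<open>4 * (du \<phi> p)\<^sup>2\<close>; likewise in \<open>v\<close>.\<close>
  have u: "2 * (du M p + du \<Gamma> p) * du U p = 2 * du M p * du U p + 4 * (du \<phi> p)\<^sup>2"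
    and v: "2 * (dv M p + dv \<Gamma> p) * dv U p = 2 * dv M p * dv U p + 4 * (dv \<phi> p)\<^sup>2" if "p \<in> D" for p
    using assms(8,9) that by (auto simp: algebra_simps)
  show ?thesis
    unfolding CEMS_solution_def
  proof (intro conjI ballI)
    fix p assume p: "p \<in> D"
    \<comment> \<open>Stripping the seven regularity conjuncts leaves the nine field equations at
      \<open>p\<close>, with the scalar terms zero.\<close>
    note eqs = sol[unfolded zero, THEN conjunct2, THEN conjunct2, THEN conjunct2,
        THEN conjunct2, THEN conjunct2, THEN conjunct2, THEN conjunct2, THEN bspec, OF p]
    show "2 * dv (du (\<lambda>p. M p + \<Gamma> p)) p =
        - du U p * dv U p + du W p * dv W p + du V p * dv V p * (cosh (W p))\<^sup>2
        + 4 * du \<phi> p * dv \<phi> p"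
      using eqs by (simp add: M[OF p])
    show "complex_of_real (2 * du (du U) p - (du U p)\<^sup>2 + 2 * du (\<lambda>p. M p + \<Gamma> p) p * du U p) =
        complex_of_real ((du W p)\<^sup>2 + (du V p)\<^sup>2 * (cosh (W p))\<^sup>2 + 4 * (du \<phi> p)\<^sup>2)
        + complex_of_real (4 * k) * (Phi2 U V W A B p * cnj (Phi2 U V W A B p))"
      using eqs[THEN conjunct2, THEN conjunct2, THEN conjunct2, THEN conjunct2, THEN conjunct2,
          THEN conjunct2, THEN conjunct2, THEN conjunct1]
      unfolding M[OF p] u[OF p] of_real_add of_real_diff by (simp add: algebra_simps)
    show "complex_of_real (2 * dv (dv U) p - (dv U p)\<^sup>2 + 2 * dv (\<lambda>p. M p + \<Gamma> p) p * dv U p) =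
        complex_of_real ((dv W p)\<^sup>2 + (dv V p)\<^sup>2 * (cosh (W p))\<^sup>2 + 4 * (dv \<phi> p)\<^sup>2)
        + complex_of_real (4 * k) * (Phi0 U V W A B p * cnj (Phi0 U V W A B p))"
      using eqs[THEN conjunct2, THEN conjunct2, THEN conjunct2, THEN conjunct2, THEN conjunct2,
          THEN conjunct2, THEN conjunct2, THEN conjunct2]
      unfolding M[OF p] v[OF p] of_real_add of_real_diff by (simp add: algebra_simps)
  \<comment> \<open>What remains is regularity, the wave equation for \<phi>, and the equations
    containing neither \<open>M\<close> nor \<phi>, which carry over verbatim.\<close>
  qed (use sol assms(4,6) C2_on_add[OF assms(1) C2(2) assms(7)] in blast)+
qed

end
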